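(* Let $\Gamma$ be a simple graph on $V=\{1,\dots,n\}$ with edge ideal $I\subseteq R=k[x_1,\dots,x_n]$, let $t\ge 1$ be an integer and $\mathbf a\in\mathbb N^n$. If $x^{\mathbf a}\in\widetilde{I^t}\setminus I^t$, then $V_{\mathbf a}=\{i\in V\mid a_i>0\}$ is a dominating set of $\Gamma$.
   Context: $k$ is a field, $n\ge 1$, $\mathfrak m=(x_1,\dots,x_n)$. The edge ideal of $\Gamma$ is the ideal generated by the $x_ix_j$ with $\{i,j\}$ an edge of $\Gamma$. $x^{\mathbf a}=x_1^{a_1}\cdots x_n^{a_n}$. The saturation of an ideal $J$ of $R$ is $\widetilde J=\bigcup_{m\ge 1}(J:\mathfrak m^m)$. A subset $W\subseteq V$ is dominating if every vertex of $V\setminus W$ is adjacent to at least one vertex of $W$. *)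

theory Defs
  imports "HOL-Library.Poly_Mapping" "HOL-Algebra.Ideal_Product" "HOL-Algebra.Algebraic_Closure_Type"
begin

text \<open>
  The polynomial ring \<open>k[x\<^sub>1, \<dots>, x\<^sub>n]\<close> has its variables indexed by a finite type \<open>'n\<close> with \<open>n\<close>
  elements, which is also the vertex set of the graph; \<open>n \<ge> 1\<close> holds because types are nonempty.
  A polynomial maps each exponent vector to its coefficient.
\<close>

type_synonym ('n, 'k) mpoly = "('n \<Rightarrow>\<^sub>0 nat) \<Rightarrow>\<^sub>0 'k"

text \<open>The type above as a ring record, so that the ideal theory of HOL-Algebra applies to it.\<close>

abbreviation polynomial_ring :: "('n::finite, 'k::field) mpoly ring"
  where "polynomial_ring \<equiv> ring_of_type_algebra"

definition var :: "'n::finite \<Rightarrow> ('n, 'k::field) mpoly"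
  where "var i = Poly_Mapping.single (Poly_Mapping.single i 1) 1"

definition power_product :: "('n::finite \<Rightarrow> nat) \<Rightarrow> ('n, 'k::field) mpoly"
  where "power_product a = (\<Prod>i\<in>UNIV. var i ^ a i)"

text \<open>The monoid \<^const>\<open>ideals_set\<close> has the product of ideals as its multiplication.\<close>

abbreviation ideal_power :: "('n::finite, 'k::field) mpoly set \<Rightarrow> nat \<Rightarrow> ('n, 'k) mpoly set"
  where "ideal_power I t \<equiv> I [^]\<^bsub>ideals_set polynomial_ring\<^esub> t"

definition ideal_quotient ::
  "('n::finite, 'k::field) mpoly set \<Rightarrow> ('n, 'k) mpoly set \<Rightarrow> ('n, 'k) mpoly set"
  where "ideal_quotient J K = {f. \<forall>g\<in>K. f * g \<in> J}"

definition max_ideal :: "('n::finite, 'k::field) mpoly set"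
  where "max_ideal = Idl\<^bsub>polynomial_ring\<^esub> (range var)"

definition saturation :: "('n::finite, 'k::field) mpoly set \<Rightarrow> ('n, 'k) mpoly set"
  where "saturation J = (\<Union>m\<in>{1..}. ideal_quotient J (ideal_power max_ideal m))"

text \<open>A graph is given by its set of edges; all elements of the type \<open>'n\<close> are vertices.\<close>

definition simple_graph :: "'n set set \<Rightarrow> bool"
  where "simple_graph E \<longleftrightarrow> (\<forall>e\<in>E. card e = 2)"

definition edge_ideal :: "'n::finite set set \<Rightarrow> ('n, 'k::field) mpoly set"
  where "edge_ideal E = Idl\<^bsub>polynomial_ring\<^esub> {var i * var j | i j. {i, j} \<in> E}"

definition dominating_set :: "'n set set \<Rightarrow> 'n set \<Rightarrow> bool"
  where "dominating_set E W \<longleftrightarrow> (\<forall>v. v \<notin> W \<longrightarrow> (\<exists>w\<in>W. {v, w} \<in> E))"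

end

theory Submission
  imports Defs
begin

text \<open>
  Let \<open>v\<close> be a vertex outside \<open>V\<^sub>a\<close> with no neighbour in \<open>V\<^sub>a\<close>. Substituting \<open>1\<close> for \<open>x\<^sub>v\<close> and \<open>0\<close> for
  all other variables outside \<open>V\<^sub>a\<close> sends each generator of the edge ideal \<open>I\<close> to itself or to \<open>0\<close>,
  so it maps \<open>I\<^sup>t\<close> into \<open>I\<^sup>t\<close>. If the monomial with exponent \<open>a\<close> lies in the saturation, its product
  with some power of \<open>x\<^sub>v\<close> lies in \<open>I\<^sup>t\<close>; the substitution sends this product back to the monomial,
  which therefore lies in \<open>I\<^sup>t\<close>.
\<close>

interpretation polynomial_ring: cring "polynomial_ring :: ('n::finite, 'k::field) mpoly ring"
  by (rule cring_from_type_algebra)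

lemma carrier_polynomial_ring [simp]: "carrier polynomial_ring = UNIV"
  and zero_polynomial_ring [simp]: "\<zero>\<^bsub>polynomial_ring\<^esub> = 0"
  and add_polynomial_ring [simp]: "f \<oplus>\<^bsub>polynomial_ring\<^esub> g = f + g"
  and mult_polynomial_ring [simp]: "f \<otimes>\<^bsub>polynomial_ring\<^esub> g = f * g"
  by (simp_all add: ring_of_type_algebra_def)

text \<open>Negatives come for free, since \<open>- f\<close> is \<open>f\<close> times -1. This
  trades the subgroup condition in the record-based notion of ideal for plain closure conditions on
  the type.\<close>

lemma ideal_polynomial_ring_iff:
  fixes J :: "('n::finite, 'k::field) mpoly set"
  shows "ideal J polynomial_ring \<longleftrightarrow>
    0 \<in> J \<and> (\<forall>f\<in>J. \<forall>g\<in>J. f + g \<in> J) \<and> (\<forall>f\<in>J. \<forall>g. f * g \<in> J)" (is "_ \<longleftrightarrow> ?closed")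
proof
  assume "ideal J polynomial_ring"
  then interpret ideal J polynomial_ring .
  show ?closed
    using zero_closed a_closed I_r_closed by simp
next
  assume closed: ?closed
  show "ideal J polynomial_ring"
  proof (rule idealI)
    show "ring (polynomial_ring :: ('n, 'k) mpoly ring)"
      by (rule polynomial_ring.ring_axioms)
    show "subgroup J (add_monoid polynomial_ring)"
    proof (rule polynomial_ring.add.subgroupI)
      fix f assume "f \<in> J"
      then have "- f \<in> J"
        using closed by (metis mult_minus1_right)
      moreover have "\<ominus>\<^bsub>polynomial_ring\<^esub> f = - f"
        by (rule polynomial_ring.minus_equality) auto
      ultimately show "\<ominus>\<^bsub>polynomial_ring\<^esub> f \<in> J"
        by simp
    qed (use closed in auto)
  qed (use closed in \<open>auto simp: mult.commute\<close>)
qed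

lemma one_ideals_set [simp]: "\<one>\<^bsub>ideals_set R\<^esub> = carrier R"
  and mult_ideals_set [simp]: "J \<otimes>\<^bsub>ideals_set R\<^esub> K = ideal_prod R J K"
  by (simp_all add: ideals_set_def)

lemma power_in_ideal_power: "f \<in> J \<Longrightarrow> f ^ t \<in> ideal_power J t"
proof (induction t)
  case (Suc t)
  then show ?case
    using ideal_prod.prod [of "f ^ t" "ideal_power J t" f J polynomial_ring]
    by (simp add: mult.commute)
qed simp

lemma var_power: "var i ^ m = Poly_Mapping.single (Poly_Mapping.single i m) 1"
  by (induction m) (simp_all add: var_def mult_single flip: single_add)

lemma prod_single:
  "(\<Prod>i\<in>A. Poly_Mapping.single (e i) 1) = Poly_Mapping.single (\<Sum>i\<in>A. e i) (1 :: 'b::comm_semiring_1)"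
  by (induction A rule: infinite_finite_induct) (simp_all add: mult_single)

text \<open>Written as a single term, the monomial can be tested for membership through its one
  exponent vector.\<close>

lemma power_product_eq_single:
  obtains e where "power_product a = Poly_Mapping.single e 1" "\<And>i. Poly_Mapping.lookup e i = a i"
proof
  show "power_product a = Poly_Mapping.single (\<Sum>i\<in>UNIV. Poly_Mapping.single i (a i)) 1"
    by (simp add: power_product_def var_power prod_single)
  show "Poly_Mapping.lookup (\<Sum>i\<in>UNIV. Poly_Mapping.single i (a i)) i = a i" for i
    by (simp add: lookup_sum lookup_single when_def)
qed

lemma keys_add_nat:
  "Poly_Mapping.keys (s + u :: 'a \<Rightarrow>\<^sub>0 nat) = Poly_Mapping.keys s \<union> Poly_Mapping.keys u"
  by (auto simp: in_keys_iff lookup_add)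

text \<open>On exponent vectors, putting x_v = 1 means resetting the entry at \<open>v\<close> to 0.
  Additivity here is multiplicativity of the substitution on monomials.\<close>

lemma update_zero_add:
  "Poly_Mapping.update v 0 (s + u) = Poly_Mapping.update v 0 s + Poly_Mapping.update v 0 u"
  for s u :: "'a \<Rightarrow>\<^sub>0 'b::monoid_add"
  by (rule poly_mapping_eqI) (simp add: lookup_update lookup_add)

text \<open>
  For \<open>v \<in> W\<close> these are the polynomials each of whose terms is sent into the ideal \<open>J\<close> by the
  substitution \<open>x\<^sub>v = 1\<close> and \<open>x\<^sub>w = 0\<close> for \<open>w \<notin> W\<close>. Testing the terms one by one avoids constructing
  the homomorphism.
\<close>

definition termwise_preimage ::
  "'n::finite set \<Rightarrow> 'n \<Rightarrow> ('n, 'k::field) mpoly set \<Rightarrow> ('n, 'k) mpoly set"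
  where "termwise_preimage W v J =
    {f. \<forall>s\<in>Poly_Mapping.keys f.
      Poly_Mapping.keys s \<subseteq> W \<longrightarrow> Poly_Mapping.single (Poly_Mapping.update v 0 s) 1 \<in> J}"

lemma termwise_preimage_add:
  "f \<in> termwise_preimage W v J \<Longrightarrow> g \<in> termwise_preimage W v J \<Longrightarrow>
    f + g \<in> termwise_preimage W v J"
  using keys_add [of f g] by (auto simp: termwise_preimage_def)

text \<open>Every exponent of \<open>f * g\<close> is a sum of exponents of \<open>f\<close> and
  \<open>g\<close>, and since exponents are natural numbers both summands have support in
  \<open>W\<close> if the sum does. Three separate targets let the rule serve both absorption by an
  ideal and products of ideals.\<close>

lemma termwise_preimage_mult:
  assumes "f \<in> termwise_preimage W v J" "g \<in> termwise_preimage W v K"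
    and prod: "\<And>p q. p \<in> J \<Longrightarrow> q \<in> K \<Longrightarrow> p * q \<in> L"
  shows "f * g \<in> termwise_preimage W v L"
proof -
  have "Poly_Mapping.single (Poly_Mapping.update v 0 s) 1 \<in> L"
    if keys: "s \<in> Poly_Mapping.keys (f * g)" "Poly_Mapping.keys s \<subseteq> W" for s
  proof -
    obtain s1 s2 where s: "s = s1 + s2" "s1 \<in> Poly_Mapping.keys f" "s2 \<in> Poly_Mapping.keys g"
      using keys(1) keys_mult [of f g] by blast
    then have "Poly_Mapping.single (Poly_Mapping.update v 0 s1) 1
        * Poly_Mapping.single (Poly_Mapping.update v 0 s2) 1 \<in> L"
      using assms keys(2) by (auto simp: termwise_preimage_def keys_add_nat)
    then show ?thesis
      by (simp add: s(1) mult_single update_zero_add)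
  qed
  then show ?thesis
    by (simp add: termwise_preimage_def)
qed

lemma ideal_termwise_preimage:
  fixes J :: "('n::finite, 'k::field) mpoly set"
  assumes "ideal J polynomial_ring"
  shows "ideal (termwise_preimage W v J) polynomial_ring"
  unfolding ideal_polynomial_ring_iff
proof (intro conjI ballI allI)
  show "0 \<in> termwise_preimage W v J"
    by (simp add: termwise_preimage_def)
  fix f g :: "('n, 'k) mpoly"
  assume f: "f \<in> termwise_preimage W v J"
  \<comment> \<open>With target \<open>UNIV\<close> the condition on \<open>g\<close> is vacuous, so
    the product rule turns into absorption.\<close>
  have "g \<in> termwise_preimage W v UNIV"
    by (simp add: termwise_preimage_def)
  with f show "f * g \<in> termwise_preimage W v J"
    using assms by (auto intro: termwise_preimage_mult simp: ideal_polynomial_ring_iff)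
qed (rule termwise_preimage_add)

text \<open>The zeroth power is the whole ring. Beyond it, elements of a product of ideals are built
  from products by addition, and the preimage respects both operations.\<close>

lemma ideal_power_subset_termwise_preimage:
  assumes "J \<subseteq> termwise_preimage W v J"
  shows "ideal_power J t \<subseteq> termwise_preimage W v (ideal_power J t)"
proof (induction t)
  case 0
  show ?case
    by (simp add: termwise_preimage_def)
next
  case (Suc t)
  show ?case
  proof
    fix f assume "f \<in> ideal_power J (Suc t)"
    then have "f \<in> ideal_prod polynomial_ring (ideal_power J t) J"
      by simp
    then show "f \<in> termwise_preimage W v (ideal_power J (Suc t))"
    proof induction
      case (prod p q)
      have "p' * q' \<in> ideal_power J (Suc t)" if "p' \<in> ideal_power J t" "q' \<in> J" for p' q'
        using ideal_prod.prod [OF that, of polynomial_ring] by simp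
      then show ?case
        using prod Suc.IH assms by (auto intro: termwise_preimage_mult)
    next
      case (sum p q)
      then show ?case
        by (simp add: termwise_preimage_add)
    qed
  qed
qed

lemma ideal_edge_ideal: "ideal (edge_ideal E) polynomial_ring"
  unfolding edge_ideal_def by (rule polynomial_ring.genideal_ideal) simp

text \<open>The preimage of an ideal is an ideal, so testing the generators suffices. A generator
  with both variables in \<open>W\<close> does not involve x_v and is fixed; any other imposes no
  condition.\<close>

lemma edge_ideal_subset_termwise_preimage:
  assumes "\<And>w. {v, w} \<in> E \<Longrightarrow> w \<notin> W"
  shows "(edge_ideal E :: ('n::finite, 'k::field) mpoly set) \<subseteq> termwise_preimage W v (edge_ideal E)"
proof -
  have "(var i * var j :: ('n, 'k) mpoly) \<in> termwise_preimage W v (edge_ideal E)" if "{i, j} \<in> E" for i j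
  proof -
    let ?s = "Poly_Mapping.single i 1 + Poly_Mapping.single j (1::nat)"
    have var: "(var i * var j :: ('n, 'k) mpoly) = Poly_Mapping.single ?s 1"
      by (simp add: var_def mult_single)
    have mem: "(var i * var j :: ('n, 'k) mpoly) \<in> edge_ideal E"
      unfolding edge_ideal_def using that polynomial_ring.genideal_self [of "{var i * var j | i j. {i, j} \<in> E}"]
      by auto
    have "Poly_Mapping.update v 0 ?s = ?s" if "Poly_Mapping.keys ?s \<subseteq> W"
    proof -
      \<comment> \<open>If one end were \<open>v\<close>, the other would lie outside
        \<open>W\<close> by assumption, yet the support of \<open>?s\<close> contains both
        ends.\<close>
      have "v \<noteq> i" "v \<noteq> j"
        using that assms \<open>{i, j} \<in> E\<close> by (auto simp: keys_add_nat insert_commute)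
      then show ?thesis
        by (intro poly_mapping_eqI) (auto simp: lookup_update lookup_add lookup_single when_def)
    qed
    then show ?thesis
      using mem by (simp add: termwise_preimage_def var)
  qed
  then show ?thesis
    by (subst edge_ideal_def, intro polynomial_ring.genideal_minimal
        ideal_termwise_preimage ideal_edge_ideal) auto
qed

theorem corollary2p2:
  fixes E :: "'n::finite set set" and a :: "'n \<Rightarrow> nat" and t :: nat
  assumes "simple_graph E"
    and "t \<ge> 1"
    and "(power_product a :: ('n, 'k::field) mpoly)
           \<in> saturation (ideal_power (edge_ideal E) t) - ideal_power (edge_ideal E) t"
  shows "dominating_set E {i. a i > 0}"
proof (rule ccontr)
  assume "\<not> dominating_set E {i. a i > 0}"
  then obtain v where v: "a v = 0" and isolated: "\<And>w. {v, w} \<in> E \<Longrightarrow> a w = 0"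
    by (auto simp: dominating_set_def)
  define W where "W = insert v {i. a i > 0}"
  define J :: "('n, 'k) mpoly set" where "J = ideal_power (edge_ideal E) t"
  obtain m where m: "(power_product a :: ('n, 'k) mpoly) \<in> ideal_quotient J (ideal_power max_ideal m)"
    using assms(3) by (auto simp: saturation_def J_def)
  obtain e where e: "(power_product a :: ('n, 'k) mpoly) = Poly_Mapping.single e 1"
      "\<And>i. Poly_Mapping.lookup e i = a i"
    using power_product_eq_single [of a] by blast
  let ?s = "e + Poly_Mapping.single v m"
  have "range var \<subseteq> (max_ideal :: ('n, 'k) mpoly set)"
    unfolding max_ideal_def by (rule polynomial_ring.genideal_self) simp
  then have "(var v :: ('n, 'k) mpoly) ^ m \<in> ideal_power max_ideal m"
    by (intro power_in_ideal_power) auto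
  with m have "power_product a * var v ^ m \<in> J"
    by (simp add: ideal_quotient_def)
  then have "Poly_Mapping.single ?s 1 \<in> J"
    by (simp add: e(1) var_power mult_single)
  \<comment> \<open>Here \<open>a w = 0\<close> by the choice of \<open>v\<close>, and
    \<open>w = v\<close> is excluded because a simple graph has no loops.\<close>
  moreover have "w \<notin> W" if "{v, w} \<in> E" for w
    using that isolated [OF that] assms(1) by (auto simp: W_def simple_graph_def)
  then have "J \<subseteq> termwise_preimage W v J"
    unfolding J_def
    by (intro ideal_power_subset_termwise_preimage edge_ideal_subset_termwise_preimage)
  moreover have "Poly_Mapping.keys ?s \<subseteq> W"
    by (auto simp: W_def in_keys_iff lookup_add lookup_single e(2) when_def split: if_splits)
  ultimately have "Poly_Mapping.single (Poly_Mapping.update v 0 ?s) 1 \<in> J"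
    by (auto simp: termwise_preimage_def)
  \<comment> \<open>Since \<open>a v = 0\<close>, resetting the entry at \<open>v\<close> removes
    exactly the added exponent \<open>m\<close>.\<close>
  moreover have "Poly_Mapping.update v 0 ?s = e"
    by (rule poly_mapping_eqI) (auto simp: lookup_update lookup_add lookup_single e(2) v when_def)
  ultimately have "power_product a \<in> J"
    by (simp add: e(1))
  then show False
    using assms(3) by (simp add: J_def)
qed

end
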